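(* Let $X$ be a metric space, $\varphi_1,\varphi_2\colon X\to\mathbb{R}_\infty$, and $U\subset X$ with $\operatorname{dom}\varphi_1\cap\operatorname{dom}\varphi_2\cap U\ne\emptyset$. The pair $(\varphi_1,\varphi_2)$ is firmly uniformly lower semicontinuous on $U$ provided that one of the following conditions is satisfied: (i) there is a $c\in\mathbb{R}$ such that $\varphi_2(x)=c$ for all $x\in\operatorname{dom}\varphi_1\cap U$ and $\varphi_2(x)\ge c$ for all $x\in U\setminus\operatorname{dom}\varphi_1$ (or simply $\varphi_2(x)=c$ for all $x\in U$); (ii) $\operatorname{dom}\varphi_2\cap U=\{\bar x\}$, $\bar x\in\operatorname{dom}\varphi_1$ and $\varphi_1$ is lower semicontinuous at $\bar x$; (iii) $\varphi_2$ is uniformly continuous on $U$ (in particular, finite on $U$).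
   Context: $\mathbb{R}_\infty:=\mathbb{R}\cup\{+\infty\}$, $\operatorname{dom}\varphi:=\{x\mid\varphi(x)<+\infty\}$. For $x_1\in\operatorname{dom}\varphi_1$, $x_2\in\operatorname{dom}\varphi_2$ put $$(\varphi_1\diamondsuit\varphi_2)_U(x_1,x_2):=\inf_{x\in U}\max\{d(x,x_1),\,d(x,x_2),\,(\varphi_1+\varphi_2)(x)-\varphi_1(x_1)-\varphi_2(x_2)\}.$$ The pair $(\varphi_1,\varphi_2)$ is firmly uniformly lower semicontinuous on $U$ if $$\Theta_U^\circ(\varphi_1,\varphi_2):=\limsup_{\substack{d(x_1,x_2)\to0\\ x_1\in\operatorname{dom}\varphi_1\cap U,\,x_2\in\operatorname{dom}\varphi_2\cap U}}(\varphi_1\diamondsuit\varphi_2)_U(x_1,x_2)=0,$$ where the limsup is $\lim_{\eta\downarrow0}$ of the supremum over the indicated pairs with $d(x_1,x_2)<\eta$. *)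

theory Defs
  imports "HOL-Analysis.Analysis"
begin

text \<open>
  Functions into the reals extended by plus infinity are rendered as \<open>'a \<Rightarrow> ereal\<close> never
  taking the value \<open>-\<infinity>\<close>; hence all sums below are unambiguous.
\<close>

definition ext_real_fun :: "('a \<Rightarrow> ereal) \<Rightarrow> bool"
  where "ext_real_fun \<phi> \<longleftrightarrow> (\<forall>x. \<phi> x \<noteq> -\<infinity>)"

definition edom :: "('a \<Rightarrow> ereal) \<Rightarrow> 'a set"
  where "edom \<phi> = {x. \<phi> x < \<infinity>}"

text \<open>Only meaningful for \<open>x1 \<in> edom \<phi>1\<close> and \<open>x2 \<in> edom \<phi>2\<close>, where both subtrahends are finite.\<close>

definition diamond ::
  "('a::metric_space \<Rightarrow> ereal) \<Rightarrow> ('a \<Rightarrow> ereal) \<Rightarrow> 'a set \<Rightarrow> 'a \<Rightarrow> 'a \<Rightarrow> ereal"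
  where "diamond \<phi>1 \<phi>2 U x1 x2 =
    (INF x\<in>U. max (ereal (dist x x1))
               (max (ereal (dist x x2)) ((\<phi>1 x + \<phi>2 x) - \<phi>1 x1 - \<phi>2 x2)))"

definition diamond_sup ::
  "('a::metric_space \<Rightarrow> ereal) \<Rightarrow> ('a \<Rightarrow> ereal) \<Rightarrow> 'a set \<Rightarrow> real \<Rightarrow> ereal"
  where "diamond_sup \<phi>1 \<phi>2 U \<eta> =
    (SUP (x1, x2) \<in> {(x1, x2). x1 \<in> edom \<phi>1 \<inter> U \<and> x2 \<in> edom \<phi>2 \<inter> U \<and> dist x1 x2 < \<eta>}.
       diamond \<phi>1 \<phi>2 U x1 x2)"

definition Theta_firm ::
  "('a::metric_space \<Rightarrow> ereal) \<Rightarrow> ('a \<Rightarrow> ereal) \<Rightarrow> 'a set \<Rightarrow> ereal"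
  where "Theta_firm \<phi>1 \<phi>2 U = Lim (at_right 0) (diamond_sup \<phi>1 \<phi>2 U)"

text \<open>The limit always exists, because the suprema decrease as \<open>\<eta>\<close> decreases.\<close>

lemma diamond_sup_tendsto:
  "(diamond_sup \<phi>1 \<phi>2 U \<longlongrightarrow> (INF \<eta>\<in>{0<..}. diamond_sup \<phi>1 \<phi>2 U \<eta>)) (at_right 0)"
proof (rule decreasing_tendsto)
  show "\<forall>\<^sub>F \<eta> in at_right 0. (INF \<eta>\<in>{0<..}. diamond_sup \<phi>1 \<phi>2 U \<eta>) \<le> diamond_sup \<phi>1 \<phi>2 U \<eta>"
    by (auto intro!: INF_lower eventually_mono[OF eventually_at_right_less])
next
  fix y assume "(INF \<eta>\<in>{0<..}. diamond_sup \<phi>1 \<phi>2 U \<eta>) < y"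
  then obtain e where e: "0 < e" "diamond_sup \<phi>1 \<phi>2 U e < y"
    by (auto simp: INF_less_iff)
  have mono: "diamond_sup \<phi>1 \<phi>2 U \<eta> \<le> diamond_sup \<phi>1 \<phi>2 U e" if "\<eta> < e" for \<eta>
    unfolding diamond_sup_def using that by (intro SUP_subset_mono) auto
  show "\<forall>\<^sub>F \<eta> in at_right 0. diamond_sup \<phi>1 \<phi>2 U \<eta> < y"
    unfolding eventually_at_right_field using e mono by (meson le_less_trans)
qed

lemma Theta_firm_eq_INF:
  "Theta_firm \<phi>1 \<phi>2 U = (INF \<eta>\<in>{0<..}. diamond_sup \<phi>1 \<phi>2 U \<eta>)"
  unfolding Theta_firm_def by (intro tendsto_Lim diamond_sup_tendsto) simp

definition firmly_uniformly_lsc_on ::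
  "'a::metric_space set \<Rightarrow> ('a \<Rightarrow> ereal) \<Rightarrow> ('a \<Rightarrow> ereal) \<Rightarrow> bool"
  where "firmly_uniformly_lsc_on U \<phi>1 \<phi>2 \<longleftrightarrow> Theta_firm \<phi>1 \<phi>2 U = 0"

definition lsc_at :: "'a::topological_space \<Rightarrow> ('a \<Rightarrow> ereal) \<Rightarrow> bool"
  where "lsc_at x \<phi> \<longleftrightarrow> \<phi> x \<le> Liminf (at x) \<phi>"

text \<open>
  The type \<open>ereal\<close> carries no uniformity, so uniform continuity of an extended-real-valued
  function means finiteness together with uniform continuity of its real-valued version.
\<close>

definition ext_uniformly_continuous_on :: "'a::metric_space set \<Rightarrow> ('a \<Rightarrow> ereal) \<Rightarrow> bool"
  where "ext_uniformly_continuous_on U \<phi> \<longleftrightarrow>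
    (\<forall>x\<in>U. \<bar>\<phi> x\<bar> \<noteq> \<infinity>) \<and> uniformly_continuous_on U (\<lambda>x. real_of_ereal (\<phi> x))"

end

theory Submission
  imports Defs
begin

text \<open>
  The quantity \<open>Theta_firm \<phi>1 \<phi>2 U\<close> is never negative: the distances inside the maximum are
  nonnegative, and since \<open>dom \<phi>1 \<inter> dom \<phi>2 \<inter> U\<close> contains a point \<open>x0\<close>, the pair \<open>(x0, x0)\<close> competes
  in every supremum. So the property only asks that, for each \<open>\<epsilon> > 0\<close>, any two sufficiently
  close points \<open>x1 \<in> dom \<phi>1 \<inter> U\<close> and \<open>x2 \<in> dom \<phi>2 \<inter> U\<close> admit a common point \<open>x \<in> U\<close> within \<open>\<epsilon>\<close>
  of both at which \<open>\<phi>1 + \<phi>2\<close> exceeds \<open>\<phi>1 x1 + \<phi>2 x2\<close> by at most \<open>\<epsilon>\<close>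
  (\<open>firmly_uniformly_lsc_onI\<close>).

  In cases (i) and (iii) the choice \<open>x = x1\<close> works. The excess is then \<open>\<phi>2 x1 - \<phi>2 x2\<close>, which is
  nonpositive when \<open>\<phi>2\<close> equals its lower bound \<open>c\<close> on the domain of \<open>\<phi>1\<close>, and small
  when \<open>\<phi>2\<close> is uniformly continuous; both are instances of
  \<open>firmly_uniformly_lsc_on_of_second\<close>. In case (ii) the only possible \<open>x2\<close> is \<open>xbar\<close>, and
  \<open>x = xbar\<close> works: the excess is \<open>\<phi>1 xbar - \<phi>1 x1\<close>, which lower semicontinuity makes small.
\<close>

lemma diamond_nonneg: "0 \<le> diamond \<phi>1 \<phi>2 U x1 x2"
  unfolding diamond_def by (intro INF_greatest) (simp add: le_max_iff_disj)

lemma Theta_firm_nonneg: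
  assumes "edom \<phi>1 \<inter> edom \<phi>2 \<inter> U \<noteq> {}"
  shows "0 \<le> Theta_firm \<phi>1 \<phi>2 U"
  unfolding Theta_firm_eq_INF
proof (rule INF_greatest)
  fix \<eta> :: real assume "\<eta> \<in> {0<..}"
  moreover obtain x0 where "x0 \<in> edom \<phi>1 \<inter> edom \<phi>2 \<inter> U"
    using assms by blast
  ultimately have "diamond \<phi>1 \<phi>2 U x0 x0 \<le> diamond_sup \<phi>1 \<phi>2 U \<eta>"
    unfolding diamond_sup_def by (intro SUP_upper2[of "(x0, x0)"]) auto
  then show "0 \<le> diamond_sup \<phi>1 \<phi>2 U \<eta>"
    using diamond_nonneg order_trans by blast
qed

text \<open>
  A single common point \<open>x\<close> already bounds the infimum from above; the nonempty
  intersection of the domains supplies the opposite inequality.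
\<close>

lemma firmly_uniformly_lsc_onI:
  assumes ne: "edom \<phi>1 \<inter> edom \<phi>2 \<inter> U \<noteq> {}"
    and ex: "\<And>\<epsilon>::real. \<epsilon> > 0 \<Longrightarrow> \<exists>\<eta>>0. \<forall>x1 \<in> edom \<phi>1 \<inter> U. \<forall>x2 \<in> edom \<phi>2 \<inter> U. dist x1 x2 < \<eta> \<longrightarrow>
      (\<exists>x\<in>U. dist x x1 \<le> \<epsilon> \<and> dist x x2 \<le> \<epsilon> \<and> (\<phi>1 x + \<phi>2 x) - \<phi>1 x1 - \<phi>2 x2 \<le> ereal \<epsilon>)"
  shows "firmly_uniformly_lsc_on U \<phi>1 \<phi>2"
proof -
  have "Theta_firm \<phi>1 \<phi>2 U \<le> 0 + ereal \<epsilon>" if \<epsilon>: "\<epsilon> > 0" for \<epsilon> :: real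
  proof -
    obtain \<eta> where "\<eta> > 0" and \<eta>: "\<And>x1 x2. \<lbrakk>x1 \<in> edom \<phi>1 \<inter> U; x2 \<in> edom \<phi>2 \<inter> U; dist x1 x2 < \<eta>\<rbrakk> \<Longrightarrow>
        \<exists>x\<in>U. dist x x1 \<le> \<epsilon> \<and> dist x x2 \<le> \<epsilon> \<and> (\<phi>1 x + \<phi>2 x) - \<phi>1 x1 - \<phi>2 x2 \<le> ereal \<epsilon>"
      using ex[OF \<epsilon>] by blast
    have "diamond \<phi>1 \<phi>2 U x1 x2 \<le> ereal \<epsilon>"
      if x12: "x1 \<in> edom \<phi>1 \<inter> U" "x2 \<in> edom \<phi>2 \<inter> U" "dist x1 x2 < \<eta>" for x1 x2
    proof -
      obtain x where "x \<in> U" "dist x x1 \<le> \<epsilon>" "dist x x2 \<le> \<epsilon>"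
          "(\<phi>1 x + \<phi>2 x) - \<phi>1 x1 - \<phi>2 x2 \<le> ereal \<epsilon>"
        using \<eta>[OF x12] by blast
      then show ?thesis
        unfolding diamond_def by (intro INF_lower2[of x]) auto
    qed
    then have "diamond_sup \<phi>1 \<phi>2 U \<eta> \<le> ereal \<epsilon>"
      unfolding diamond_sup_def by (intro SUP_least) auto
    with \<open>\<eta> > 0\<close> show ?thesis
      unfolding Theta_firm_eq_INF by (intro INF_lower2[of \<eta>]) auto
  qed
  then have "Theta_firm \<phi>1 \<phi>2 U \<le> 0"
    using ereal_le_epsilon2 by blast
  with Theta_firm_nonneg[OF ne] show ?thesis
    unfolding firmly_uniformly_lsc_on_def by (rule order_antisym[rotated])
qed

text \<open>
  A one-sided uniform condition on \<open>\<phi>2\<close> alone is enough, because with \<open>x = x1\<close> the values of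
  \<open>\<phi>1\<close> cancel.
\<close>

lemma firmly_uniformly_lsc_on_of_second:
  assumes "ext_real_fun \<phi>1" and "ext_real_fun \<phi>2"
    and ne: "edom \<phi>1 \<inter> edom \<phi>2 \<inter> U \<noteq> {}"
    and ex: "\<And>\<epsilon>::real. \<epsilon> > 0 \<Longrightarrow> \<exists>\<eta>>0. \<forall>x1 \<in> edom \<phi>1 \<inter> U. \<forall>x2 \<in> edom \<phi>2 \<inter> U.
      dist x1 x2 < \<eta> \<longrightarrow> \<phi>2 x1 \<le> \<phi>2 x2 + ereal \<epsilon>"
  shows "firmly_uniformly_lsc_on U \<phi>1 \<phi>2"
proof (rule firmly_uniformly_lsc_onI[OF ne])
  fix \<epsilon> :: real assume "\<epsilon> > 0"
  then obtain \<eta> where "\<eta> > 0" and \<eta>: "\<And>x1 x2. \<lbrakk>x1 \<in> edom \<phi>1 \<inter> U; x2 \<in> edom \<phi>2 \<inter> U;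
      dist x1 x2 < \<eta>\<rbrakk> \<Longrightarrow> \<phi>2 x1 \<le> \<phi>2 x2 + ereal \<epsilon>"
    using ex by blast
  have "\<exists>x\<in>U. dist x x1 \<le> \<epsilon> \<and> dist x x2 \<le> \<epsilon> \<and> (\<phi>1 x + \<phi>2 x) - \<phi>1 x1 - \<phi>2 x2 \<le> ereal \<epsilon>"
    if x1: "x1 \<in> edom \<phi>1 \<inter> U" and x2: "x2 \<in> edom \<phi>2 \<inter> U" and d: "dist x1 x2 < min \<eta> \<epsilon>"
    for x1 x2
  proof -
    have "\<bar>\<phi>1 x1\<bar> \<noteq> \<infinity>" "\<bar>\<phi>2 x2\<bar> \<noteq> \<infinity>" "\<phi>2 x1 \<noteq> -\<infinity>"
      using x1 x2 assms(1,2) by (auto simp: edom_def ext_real_fun_def)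
    moreover have "\<phi>2 x1 \<le> \<phi>2 x2 + ereal \<epsilon>"
      using \<eta> x1 x2 d by simp
    ultimately have "(\<phi>1 x1 + \<phi>2 x1) - \<phi>1 x1 - \<phi>2 x2 \<le> ereal \<epsilon>"
      by (cases "\<phi>1 x1"; cases "\<phi>2 x1"; cases "\<phi>2 x2") auto
    then show ?thesis
      using x1 d \<open>\<epsilon> > 0\<close> by (intro bexI[of _ x1]) auto
  qed
  then show "\<exists>\<eta>>0. \<forall>x1 \<in> edom \<phi>1 \<inter> U. \<forall>x2 \<in> edom \<phi>2 \<inter> U. dist x1 x2 < \<eta> \<longrightarrow>
      (\<exists>x\<in>U. dist x x1 \<le> \<epsilon> \<and> dist x x2 \<le> \<epsilon> \<and> (\<phi>1 x + \<phi>2 x) - \<phi>1 x1 - \<phi>2 x2 \<le> ereal \<epsilon>)"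
    using \<open>\<eta> > 0\<close> \<open>\<epsilon> > 0\<close> by (intro exI[of _ "min \<eta> \<epsilon>"]) auto
qed

lemma lsc_at_epsilon:
  fixes \<phi> :: "'a::metric_space \<Rightarrow> ereal"
  assumes lsc: "lsc_at x \<phi>" and fin: "\<bar>\<phi> x\<bar> \<noteq> \<infinity>" and "\<epsilon> > 0"
  shows "\<exists>\<eta>>0. \<forall>y. dist y x < \<eta> \<longrightarrow> \<phi> x \<le> \<phi> y + ereal \<epsilon>"
proof -
  have "\<phi> x - ereal \<epsilon> < \<phi> x"
    using fin \<open>\<epsilon> > 0\<close> by (cases "\<phi> x") auto
  then have "\<forall>\<^sub>F y in at x. \<phi> x - ereal \<epsilon> < \<phi> y"
    using lsc unfolding lsc_at_def le_Liminf_iff by blast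
  then obtain \<eta> where "\<eta> > 0" and \<eta>: "\<And>y. \<lbrakk>y \<noteq> x; dist y x < \<eta>\<rbrakk> \<Longrightarrow> \<phi> x - ereal \<epsilon> < \<phi> y"
    by (auto simp: eventually_at)
  \<comment> \<open>The punctured filter says nothing about \<open>y = x\<close>, where the bound holds because \<open>\<epsilon> > 0\<close>.\<close>
  then have "\<phi> x - ereal \<epsilon> < \<phi> y" if "dist y x < \<eta>" for y
    using that \<open>\<phi> x - ereal \<epsilon> < \<phi> x\<close> by (cases "y = x") auto
  then have "\<phi> x \<le> \<phi> y + ereal \<epsilon>" if "dist y x < \<eta>" for y
    using less_imp_le[of "\<phi> x - ereal \<epsilon>" "\<phi> y"] that by (simp add: ereal_minus_le)
  with \<open>\<eta> > 0\<close> show ?thesis by blast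
qed

lemma firmly_uniformly_lsc_on_singleton_domain:
  assumes "ext_real_fun \<phi>1" and "ext_real_fun \<phi>2"
    and dom2: "edom \<phi>2 \<inter> U = {xbar}" and "xbar \<in> edom \<phi>1" and lsc: "lsc_at xbar \<phi>1"
  shows "firmly_uniformly_lsc_on U \<phi>1 \<phi>2"
proof (rule firmly_uniformly_lsc_onI)
  show "edom \<phi>1 \<inter> edom \<phi>2 \<inter> U \<noteq> {}"
    using dom2 \<open>xbar \<in> edom \<phi>1\<close> by blast
  have xbar: "xbar \<in> U" "\<bar>\<phi>1 xbar\<bar> \<noteq> \<infinity>" "\<bar>\<phi>2 xbar\<bar> \<noteq> \<infinity>"
    using assms by (auto simp: edom_def ext_real_fun_def)
  fix \<epsilon> :: real assume "\<epsilon> > 0"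
  then obtain \<eta> where "\<eta> > 0" and \<eta>: "\<And>y. dist y xbar < \<eta> \<Longrightarrow> \<phi>1 xbar \<le> \<phi>1 y + ereal \<epsilon>"
    using lsc_at_epsilon[OF lsc xbar(2)] by blast
  have "\<exists>x\<in>U. dist x x1 \<le> \<epsilon> \<and> dist x x2 \<le> \<epsilon> \<and> (\<phi>1 x + \<phi>2 x) - \<phi>1 x1 - \<phi>2 x2 \<le> ereal \<epsilon>"
    if x1: "x1 \<in> edom \<phi>1 \<inter> U" and x2: "x2 \<in> edom \<phi>2 \<inter> U" and d: "dist x1 x2 < min \<eta> \<epsilon>"
    for x1 x2
  proof -
    have [simp]: "x2 = xbar"
      using x2 dom2 by blast
    have "\<bar>\<phi>1 x1\<bar> \<noteq> \<infinity>"
      using x1 assms(1) by (auto simp: edom_def ext_real_fun_def)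
    moreover have "\<phi>1 xbar \<le> \<phi>1 x1 + ereal \<epsilon>"
      using \<eta> d by simp
    ultimately have "(\<phi>1 xbar + \<phi>2 xbar) - \<phi>1 x1 - \<phi>2 x2 \<le> ereal \<epsilon>"
      using xbar by (cases "\<phi>1 xbar"; cases "\<phi>2 xbar"; cases "\<phi>1 x1") auto
    then show ?thesis
      using xbar(1) d \<open>\<epsilon> > 0\<close> by (intro bexI[of _ xbar]) (auto simp: dist_commute)
  qed
  then show "\<exists>\<eta>>0. \<forall>x1 \<in> edom \<phi>1 \<inter> U. \<forall>x2 \<in> edom \<phi>2 \<inter> U. dist x1 x2 < \<eta> \<longrightarrow>
      (\<exists>x\<in>U. dist x x1 \<le> \<epsilon> \<and> dist x x2 \<le> \<epsilon> \<and> (\<phi>1 x + \<phi>2 x) - \<phi>1 x1 - \<phi>2 x2 \<le> ereal \<epsilon>)"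
    using \<open>\<eta> > 0\<close> \<open>\<epsilon> > 0\<close> by (intro exI[of _ "min \<eta> \<epsilon>"]) auto
qed

lemma ext_uniformly_continuous_on_epsilon:
  assumes uc: "ext_uniformly_continuous_on U \<phi>" and "\<epsilon> > 0"
  shows "\<exists>\<eta>>0. \<forall>x\<in>U. \<forall>y\<in>U. dist x y < \<eta> \<longrightarrow> \<phi> x \<le> \<phi> y + ereal \<epsilon>"
proof -
  obtain \<eta> where "\<eta> > 0" and \<eta>: "\<And>x y. \<lbrakk>x \<in> U; y \<in> U; dist x y < \<eta>\<rbrakk> \<Longrightarrow>
      dist (real_of_ereal (\<phi> x)) (real_of_ereal (\<phi> y)) < \<epsilon>"
    using uc \<open>\<epsilon> > 0\<close> unfolding ext_uniformly_continuous_on_def uniformly_continuous_on_def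
    by (metis dist_commute)
  have "\<phi> x \<le> \<phi> y + ereal \<epsilon>" if "x \<in> U" "y \<in> U" "dist x y < \<eta>" for x y
  proof -
    have "\<bar>\<phi> x\<bar> \<noteq> \<infinity>" "\<bar>\<phi> y\<bar> \<noteq> \<infinity>"
      using uc that unfolding ext_uniformly_continuous_on_def by auto
    then show ?thesis
      using \<eta>[OF that] by (cases "\<phi> x"; cases "\<phi> y") (auto simp: dist_real_def)
  qed
  with \<open>\<eta> > 0\<close> show ?thesis by blast
qed

theorem proposition4p8:
  fixes \<phi>1 \<phi>2 :: "'a::metric_space \<Rightarrow> ereal" and U :: "'a set"
  assumes "ext_real_fun \<phi>1" and "ext_real_fun \<phi>2"
    and "edom \<phi>1 \<inter> edom \<phi>2 \<inter> U \<noteq> {}"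
    and "(\<exists>c::real. ((\<forall>x \<in> edom \<phi>1 \<inter> U. \<phi>2 x = ereal c) \<and> (\<forall>x \<in> U - edom \<phi>1. \<phi>2 x \<ge> ereal c))
              \<or> (\<forall>x\<in>U. \<phi>2 x = ereal c))
      \<or> (\<exists>xbar. edom \<phi>2 \<inter> U = {xbar} \<and> xbar \<in> edom \<phi>1 \<and> lsc_at xbar \<phi>1)
      \<or> ext_uniformly_continuous_on U \<phi>2"
  shows "firmly_uniformly_lsc_on U \<phi>1 \<phi>2"
  using assms(4)
proof (elim disjE)
  assume "\<exists>c::real. ((\<forall>x \<in> edom \<phi>1 \<inter> U. \<phi>2 x = ereal c) \<and> (\<forall>x \<in> U - edom \<phi>1. \<phi>2 x \<ge> ereal c))
              \<or> (\<forall>x\<in>U. \<phi>2 x = ereal c)"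
  then obtain c :: real
    where eq: "\<And>x. x \<in> edom \<phi>1 \<inter> U \<Longrightarrow> \<phi>2 x = ereal c" and ge: "\<And>x. x \<in> U \<Longrightarrow> ereal c \<le> \<phi>2 x"
    by (metis DiffI IntI Int_iff order_refl)
  have "\<phi>2 x1 \<le> \<phi>2 x2 + ereal \<epsilon>" if "\<epsilon> > 0" "x1 \<in> edom \<phi>1 \<inter> U" "x2 \<in> U" for \<epsilon> x1 x2
    using eq[OF that(2)] ge[OF that(3)] \<open>\<epsilon> > 0\<close> by (cases "\<phi>2 x2") auto
  then show ?thesis
    by (intro firmly_uniformly_lsc_on_of_second[OF assms(1-3)] exI[of _ 1]) auto
next
  assume "\<exists>xbar. edom \<phi>2 \<inter> U = {xbar} \<and> xbar \<in> edom \<phi>1 \<and> lsc_at xbar \<phi>1"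
  then show ?thesis
    using firmly_uniformly_lsc_on_singleton_domain[OF assms(1,2)] by blast
next
  assume "ext_uniformly_continuous_on U \<phi>2"
  then show ?thesis
    by (intro firmly_uniformly_lsc_on_of_second[OF assms(1-3)])
      (meson IntD2 ext_uniformly_continuous_on_epsilon)
qed

end
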